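(* Let $\mathcal{A}$ be a deformation of the braid arrangement in $V_{n-1}$, and consider any valid $m$-acyclic weighted digraph representing a region of $\mathcal{A}$. If there is a directed path $i_1\rightarrow i_2\rightarrow\cdots\rightarrow i_k$ and a directed edge $i_1\rightarrow i_k$ such that $$w(i_1,i_2)+w(i_2,i_3)+\cdots+w(i_{k-1},i_k)\ge w(i_1,i_k)$$ holds, then the linear inequality represented by the weighted edge $i_1\rightarrow i_k$ is a consequence of the inequalities represented by the edges in the directed path $i_1\rightarrow i_2\rightarrow\cdots\rightarrow i_k$.
   Context: $V_{n-1}=\{x\in\mathbb{R}^n: x_1+\cdots+x_n=0\}$. A deformation of the braid arrangement is the set of hyperplanes $x_i-x_j=a_{ij}^{(1)},\ldots,a_{ij}^{(n_{ij})}$ in $V_{n-1}$, $1\le i<j\le n$, where the $n_{ij}$ are nonnegative integers and $a_{ij}^{(1)}<\cdots<a_{ij}^{(n_{ij})}$ are real numbers. Its regions are the connected components of the complement of the hyperplanes. The valid weighted digraph representing a region $R$ has vertex set $\{1,\ldots,n\}$; for each $i<j$ with $n_{ij}>0$: if $x_i-x_j<a_{ij}^{(1)}$ on $R$ it has only an edge $j\rightarrow i$, of weight $-a_{ij}^{(1)}$; if $a_{ij}^{(k)}<x_i-x_j<a_{ij}^{(k+1)}$ on $R$ it has an edge $i\rightarrow j$ of weight $a_{ij}^{(k)}$ and an edge $j\rightarrow i$ of weight $-a_{ij}^{(k+1)}$; if $x_i-x_j>a_{ij}^{(n_{ij})}$ on $R$ it has only an edge $i\rightarrow j$, of weight $a_{ij}^{(n_{ij})}$.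 If $n_{ij}=0$ there is no edge between $i$ and $j$. These digraphs are $m$-acyclic: they have no directed cycle of nonnegative total weight. $w(i,j)$ denotes the weight of the edge $i\rightarrow j$. The linear inequality represented by an edge $i\rightarrow j$ (for any order of $i$ and $j$) is $x_i-x_j>w(i,j)$. An inequality is a consequence of a set of inequalities if every point satisfying all inequalities in the set satisfies it. *)

theory Defs
  imports "HOL-Analysis.Analysis" "Graph_Theory.Pair_Digraph"
begin

text \<open>Coordinates are indexed by a finite linearly ordered type, playing the role of
  \<open>{1, ..., n}\<close> with its usual order.\<close>

definition sum_zero_space :: "(real ^ 'n) set" where
  "sum_zero_space = {x. (\<Sum>i\<in>UNIV. x $ i) = 0}"

text \<open>A deformation of the braid arrangement is given by the number \<open>N i j\<close> of hyperplanes
  parallel to \<open>x\<^sub>i = x\<^sub>j\<close> and their offsets \<open>a i j 1 < ... < a i j (N i j)\<close>.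
  Only the values with \<open>i < j\<close> and \<open>1 \<le> k \<le> N i j\<close> are meaningful.\<close>

definition deformation_data ::
    "('n::{finite,linorder} \<Rightarrow> 'n \<Rightarrow> nat) \<Rightarrow> ('n \<Rightarrow> 'n \<Rightarrow> nat \<Rightarrow> real) \<Rightarrow> bool" where
  "deformation_data N a \<longleftrightarrow> (\<forall>i j. i < j \<longrightarrow> strict_mono_on {1..N i j} (a i j))"

definition deformation ::
    "('n::{finite,linorder} \<Rightarrow> 'n \<Rightarrow> nat) \<Rightarrow> ('n \<Rightarrow> 'n \<Rightarrow> nat \<Rightarrow> real) \<Rightarrow> (real ^ 'n::{finite,linorder}) set set" where
  "deformation N a =
    {{x \<in> sum_zero_space. x $ i - x $ j = a i j k} | i j k. i < j \<and> k \<in> {1..N i j}}"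

definition regions :: "(real ^ 'n) set set \<Rightarrow> (real ^ 'n) set set" where
  "regions \<A> = components (sum_zero_space - \<Union>\<A>)"

text \<open>On a region, \<open>x\<^sub>i - x\<^sub>j\<close> never equals an offset \<open>a i j k\<close>, so by connectedness
  exactly one of the three cases below applies to each pair \<open>i < j\<close> with \<open>N i j > 0\<close>. The weight
  function is constrained on the edges of the digraph only.\<close>

definition represents_region ::
    "('n::{finite,linorder} \<Rightarrow> 'n \<Rightarrow> nat) \<Rightarrow> ('n \<Rightarrow> 'n \<Rightarrow> nat \<Rightarrow> real) \<Rightarrow>
      'n pair_pre_digraph \<Rightarrow> ('n \<times> 'n \<Rightarrow> real) \<Rightarrow> (real ^ 'n::{finite,linorder}) set \<Rightarrow> bool" where
  "represents_region N a G w R \<longleftrightarrow>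
    pverts G = UNIV \<and>
    (\<forall>i. (i, i) \<notin> parcs G) \<and>
    (\<forall>i j. i < j \<longrightarrow>
      (N i j = 0 \<longrightarrow> (i, j) \<notin> parcs G \<and> (j, i) \<notin> parcs G) \<and>
      (N i j > 0 \<longrightarrow>
        ((\<forall>x\<in>R. x $ i - x $ j < a i j 1) \<longrightarrow>
          (i, j) \<notin> parcs G \<and> (j, i) \<in> parcs G \<and> w (j, i) = - a i j 1) \<and>
        (\<forall>k\<in>{1..<N i j}.
          (\<forall>x\<in>R. a i j k < x $ i - x $ j \<and> x $ i - x $ j < a i j (k + 1)) \<longrightarrow>
            (i, j) \<in> parcs G \<and> w (i, j) = a i j k \<and>
            (j, i) \<in> parcs G \<and> w (j, i) = - a i j (k + 1)) \<and>
        ((\<forall>x\<in>R. x $ i - x $ j > a i j (N i j)) \<longrightarrow>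
          (i, j) \<in> parcs G \<and> w (i, j) = a i j (N i j) \<and> (j, i) \<notin> parcs G)))"

definition m_acyclic :: "'v pair_pre_digraph \<Rightarrow> ('v \<times> 'v \<Rightarrow> real) \<Rightarrow> bool" where
  "m_acyclic G w \<longleftrightarrow> (\<nexists>c. pre_digraph.cycle (with_proj G) c \<and> (\<Sum>e\<leftarrow>c. w e) \<ge> 0)"

definition edge_ineq :: "('n \<times> 'n \<Rightarrow> real) \<Rightarrow> 'n \<times> 'n \<Rightarrow> real ^ 'n \<Rightarrow> bool" where
  "edge_ineq w e x \<longleftrightarrow> x $ fst e - x $ snd e > w e"

text \<open>Inequalities are viewed as predicates on the points of the ambient space
  \<^term>\<open>sum_zero_space\<close> of the arrangement.\<close>

definition consequence :: "(real ^ 'n \<Rightarrow> bool) \<Rightarrow> (real ^ 'n \<Rightarrow> bool) set \<Rightarrow> bool" where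
  "consequence \<phi> \<Phi> \<longleftrightarrow> (\<forall>x\<in>sum_zero_space. (\<forall>\<psi>\<in>\<Phi>. \<psi> x) \<longrightarrow> \<phi> x)"

end

theory Submission
  imports Defs
begin

text \<open>Along a directed path from \<open>u\<close> to \<open>v\<close> the differences \<open>x\<^sub>i - x\<^sub>j\<close> of its edges telescope to
  \<open>x\<^sub>u - x\<^sub>v\<close>. Adding the inequalities represented by the edges therefore bounds \<open>x\<^sub>u - x\<^sub>v\<close> strictly
  from below by the total weight of the path, which is at least the weight of the edge from \<open>u\<close>
  to \<open>v\<close>. Strictness requires the path to have an edge; a path without edges would end at its
  start and make \<open>(u, v)\<close> a loop, and the digraph of a region has no loops.\<close>

lemma cas_sum_differences:
  fixes f :: "'v \<Rightarrow> 'a::ab_group_add"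
  assumes "pre_digraph.cas (with_proj G) u p v"
  shows "(\<Sum>e\<leftarrow>p. f (fst e) - f (snd e)) = f u - f v"
  using assms
proof (induction p arbitrary: u)
  case Nil
  then show ?case by (simp add: pre_digraph.cas.simps)
next
  case (Cons e p)
  then have "fst e = u" and "pre_digraph.cas (with_proj G) (snd e) p v"
    by (simp_all add: pre_digraph.cas.simps)
  with Cons.IH[of "snd e"] show ?case by simp
qed

lemma path_weight_less_endpoint_difference:
  assumes "pre_digraph.cas (with_proj G) u p v"
    and "p \<noteq> []"
    and "\<And>e. e \<in> set p \<Longrightarrow> edge_ineq w e x"
  shows "(\<Sum>e\<leftarrow>p. w e) < x $ u - x $ v"
proof -
  have "(\<Sum>e\<leftarrow>p. w e) < (\<Sum>e\<leftarrow>p. x $ fst e - x $ snd e)"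
    using assms(2,3) by (intro sum_list_strict_mono) (auto simp: edge_ineq_def)
  then show ?thesis
    using cas_sum_differences[OF assms(1), of "\<lambda>i. x $ i"] by simp
qed

theorem lemma7p2:
  fixes N :: "'n::{finite,linorder} \<Rightarrow> 'n \<Rightarrow> nat"
    and a :: "'n \<Rightarrow> 'n \<Rightarrow> nat \<Rightarrow> real"
    and R :: "(real ^ 'n::{finite,linorder}) set"
    and G :: "'n pair_pre_digraph"
    and w :: "'n \<times> 'n \<Rightarrow> real"
    and p :: "('n \<times> 'n) list"
    and u v :: 'n
  assumes "deformation_data N a"
    and "R \<in> regions (deformation N a)"
    and "represents_region N a G w R"
    and "m_acyclic G w"
    and "pre_digraph.apath (with_proj G) u p v"
    and "(u, v) \<in> parcs G"
    and "(\<Sum>e\<leftarrow>p. w e) \<ge> w (u, v)"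
  shows "consequence (edge_ineq w (u, v)) (edge_ineq w ` set p)"
proof -
  have path: "pre_digraph.cas (with_proj G) u p v"
    using assms(5) by (simp add: pre_digraph.apath_def pre_digraph.awalk_def)
  have "u \<noteq> v"
    using assms(3,6) by (auto simp: represents_region_def)
  then have "p \<noteq> []"
    using path by (auto simp: pre_digraph.cas.simps)
  show ?thesis
    unfolding consequence_def
  proof (intro ballI impI)
    fix x :: "real ^ 'n::{finite,linorder}"
    assume "\<forall>\<psi>\<in>edge_ineq w ` set p. \<psi> x"
    then have "(\<Sum>e\<leftarrow>p. w e) < x $ u - x $ v"
      using path_weight_less_endpoint_difference[OF path \<open>p \<noteq> []\<close>, of w x] by blast
    with assms(7) show "edge_ineq w (u, v) x"
      by (simp add: edge_ineq_def)
  qed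
qed

end
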